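(* Let $n \geq 3$ be an integer and let $a<b$ be positive integers. Then the power sums $p_a, p_b$ form a regular sequence in the polynomial ring $S=\mathbb{C}[x_1,x_2,\dots,x_n]$.
   Context: For a positive integer $m$, $p_m = p_m(x_1,\dots,x_n) = \sum_{i=1}^n x_i^m \in S$ is the power sum symmetric polynomial of degree $m$. A sequence $f_1,\dots,f_k$ in $S$ is a regular sequence if the ideal $(f_1,\dots,f_k)$ is proper and, for each $i$, the image of $f_{i+1}$ is a nonzerodivisor in $S/(f_1,\dots,f_i)$. *)

theory Defs
  imports Complex_Main "HOL-Library.Poly_Mapping" "HOL-Algebra.QuotRing"
begin

definition nonzerodivisor :: "('a, 'm) ring_scheme \<Rightarrow> 'a \<Rightarrow> bool" where
  "nonzerodivisor R f \<longleftrightarrow>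
     f \<in> carrier R \<and> (\<forall>g\<in>carrier R. f \<otimes>\<^bsub>R\<^esub> g = \<zero>\<^bsub>R\<^esub> \<longrightarrow> g = \<zero>\<^bsub>R\<^esub>)"

text \<open>List indices start at 0, so \<open>fs ! i\<close> is the element $f_{i+1}$ and \<open>set (take i fs)\<close>
  is $\{f_1,\dots,f_i\}$; for \<open>i = 0\<close> the quotient is by the zero ideal. The notion is
  meant for commutative rings \<open>R\<close>.\<close>

definition regular_sequence :: "('a, 'm) ring_scheme \<Rightarrow> 'a list \<Rightarrow> bool" where
  "regular_sequence R fs \<longleftrightarrow>
     set fs \<subseteq> carrier R \<and>
     genideal R (set fs) \<noteq> carrier R \<and>
     (\<forall>i<length fs.
        nonzerodivisor (R Quot genideal R (set (take i fs)))
          (genideal R (set (take i fs)) +>\<^bsub>R\<^esub> (fs ! i)))"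

text \<open>A polynomial in the variables $x_i$ ($i$ a natural number) is a finitely supported map from
  monomials \<open>nat \<Rightarrow>\<^sub>0 nat\<close> (variable index to exponent) to coefficients; the product on this
  type is convolution. The ring in $x_1,\dots,x_n$ consists of the polynomials all of whose
  monomials involve only variables with index in \<open>{1..n}\<close>.\<close>

type_synonym 'a mpoly = "(nat \<Rightarrow>\<^sub>0 nat) \<Rightarrow>\<^sub>0 'a"

definition poly_ring :: "nat \<Rightarrow> 'a::comm_ring_1 mpoly ring" where
  "poly_ring n =
     \<lparr>carrier = {p. \<forall>m\<in>Poly_Mapping.keys p. Poly_Mapping.keys m \<subseteq> {1..n}},
      monoid.mult = (*), one = 1, ring.zero = 0, add = (+)\<rparr>"

definition var :: "nat \<Rightarrow> 'a::comm_ring_1 mpoly" where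
  "var i = Poly_Mapping.single (Poly_Mapping.single i 1) 1"

definition power_sum :: "nat \<Rightarrow> nat \<Rightarrow> 'a::comm_ring_1 mpoly" where
  "power_sum n m = (\<Sum>i=1..n. var i ^ m)"

lemma poly_ring_simps [simp]:
  "x \<otimes>\<^bsub>poly_ring n\<^esub> y = x * y" "\<one>\<^bsub>poly_ring n\<^esub> = 1"
  "\<zero>\<^bsub>poly_ring n\<^esub> = 0" "x \<oplus>\<^bsub>poly_ring n\<^esub> y = x + y"
  by (simp_all add: poly_ring_def)

lemma poly_ring_one_closed: "1 \<in> carrier (poly_ring n)"
  and poly_ring_zero_closed: "0 \<in> carrier (poly_ring n)"
  by (auto simp: poly_ring_def)

lemma poly_ring_mult_closed:
  fixes p q :: "'a::comm_ring_1 mpoly"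
  assumes "p \<in> carrier (poly_ring n)" "q \<in> carrier (poly_ring n)"
  shows "p * q \<in> carrier (poly_ring n)"
proof -
  have "Poly_Mapping.keys m \<subseteq> {1..n}" if m: "m \<in> Poly_Mapping.keys (p * q)" for m
  proof -
    obtain s t where "m = s + t" "s \<in> Poly_Mapping.keys p" "t \<in> Poly_Mapping.keys q"
      using m keys_mult[of p q] by blast
    then show ?thesis
      using assms keys_add[of s t] unfolding poly_ring_def by fastforce
  qed
  then show ?thesis by (simp add: poly_ring_def)
qed

lemma poly_ring_add_closed:
  fixes p q :: "'a::comm_ring_1 mpoly"
  assumes "p \<in> carrier (poly_ring n)" "q \<in> carrier (poly_ring n)"
  shows "p + q \<in> carrier (poly_ring n)"
  using assms keys_add[of p q] unfolding poly_ring_def by fastforce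

lemma poly_ring_cring: "cring (poly_ring n :: 'a::comm_ring_1 mpoly ring)"
proof (rule cringI)
  show "abelian_group (poly_ring n :: 'a mpoly ring)"
  proof (rule abelian_groupI)
    fix x :: "'a mpoly" assume "x \<in> carrier (poly_ring n)"
    then show "\<exists>y\<in>carrier (poly_ring n). y \<oplus>\<^bsub>poly_ring n\<^esub> x = \<zero>\<^bsub>poly_ring n\<^esub>"
      by (intro bexI[of _ "- x"]) (auto simp: poly_ring_def)
  qed (auto simp: poly_ring_add_closed poly_ring_zero_closed algebra_simps)
  show "comm_monoid (poly_ring n :: 'a mpoly ring)"
    by (rule comm_monoidI) (auto simp: poly_ring_mult_closed poly_ring_one_closed algebra_simps)
qed (auto simp: algebra_simps)

lemma var_in_poly_ring: "i \<in> {1..n} \<Longrightarrow> var i \<in> carrier (poly_ring n)"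
  by (auto simp: var_def poly_ring_def)

lemma power_sum_in_poly_ring:
  "(power_sum n m :: 'a::comm_ring_1 mpoly) \<in> carrier (poly_ring n)"
proof -
  have pow: "(var i ^ m :: 'a mpoly) \<in> carrier (poly_ring n)" if "i \<in> {1..n}" for i
    by (induction m)
      (auto intro!: poly_ring_one_closed poly_ring_mult_closed var_in_poly_ring[OF that])
  have "(\<Sum>i\<in>A. var i ^ m :: 'a mpoly) \<in> carrier (poly_ring n)"
    if "finite A" "A \<subseteq> {1..n}" for A
    using that
    by (induction A rule: finite_induct)
      (auto intro!: poly_ring_zero_closed pow poly_ring_add_closed)
  then show ?thesis by (simp add: power_sum_def)
qed

end

theory Submission
  imports Defs
begin

text \<open>Single out the variable \<open>x = x\<^sub>1\<close> and write \<open>p\<^sub>a = x\<^sup>a + c\<close>, \<open>p\<^sub>b = x\<^sup>b + d\<close>, where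
  \<open>c\<close> and \<open>d\<close> are the power sums in the other variables. The claim is that \<open>p\<^sub>b\<close> is a
  nonzerodivisor modulo \<open>p\<^sub>a\<close>; that \<open>p\<^sub>a\<close> itself is a nonzerodivisor is clear in an
  integral domain, and the ideal is proper because both power sums vanish at the origin.

  Eliminating \<open>x\<close> from \<open>p\<^sub>a\<close> and \<open>p\<^sub>b\<close> gives a polynomial without \<open>x\<close> in the ideal
  \<open>(p\<^sub>a, p\<^sub>b)\<close>. No resultant theory is needed: modulo the ideal, \<open>x\<^sup>a\<^sup>b\<close> equals both
  \<open>(-c)\<^sup>b\<close> and \<open>(-d)\<^sup>a\<close>, so \<open>r = (-c)\<^sup>b - (-d)\<^sup>a\<close> lies in it (\<open>eliminant_dvd\<close> states
  the consequence that is used: if \<open>p\<^sub>a\<close> divides \<open>p\<^sub>b g\<close>, then it divides \<open>r g\<close>).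

  The polynomial \<open>r\<close> is not zero: at the point \<open>x\<^sub>2 = x\<^sub>3 = 1\<close>, other coordinates \<open>0\<close>, both
  \<open>c\<close> and \<open>d\<close> take the value \<open>2\<close>, and \<open>(-2)\<^sup>b \<noteq> (-2)\<^sup>a\<close>
  (\<open>power_sum_tail_nonzero\<close>). This is where \<open>n \<ge> 3\<close> enters. For \<open>n = 2\<close> the eliminant can
  vanish, as it must: \<open>p\<^sub>1\<close> divides \<open>p\<^sub>3\<close> in two variables.

  Finally, \<open>p\<^sub>a\<close> is monic in \<open>x\<close>, so the quotient by \<open>p\<^sub>a\<close> is a free module with basis
  \<open>1, x, \<dots>, x\<^sup>a\<^sup>-\<^sup>1\<close> over the polynomials without \<open>x\<close>, and the nonzero element \<open>r\<close> of the
  latter domain can be cancelled (\<open>monic_dvd_mult_cancel\<close>). Hence \<open>p\<^sub>a\<close> divides \<open>g\<close>.\<close>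

section \<open>Quotient rings\<close>

lemma nonzerodivisor_Quot_iff:
  fixes R (structure)
  assumes "ideal I R" "f \<in> carrier R"
  shows "nonzerodivisor (R Quot I) (I +>\<^bsub>R\<^esub> f) \<longleftrightarrow>
    (\<forall>g\<in>carrier R. f \<otimes>\<^bsub>R\<^esub> g \<in> I \<longrightarrow> g \<in> I)"
proof -
  interpret ideal I R by fact
  have zero_iff: "I +> x = I \<longleftrightarrow> x \<in> I" if "x \<in> carrier R" for x
    using a_rcos_const a_rcos_self that by metis
  have "(\<forall>G\<in>a_rcosets I. P G) \<longleftrightarrow> (\<forall>g\<in>carrier R. P (I +> g))" for P
    by (auto simp: FactRing_simps)
  then show ?thesis
    using assms(2)
    by (auto simp: nonzerodivisor_def FactRing_def rcoset_mult_add zero_iff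
        intro!: a_rcosetsI[OF a_subset])
qed

section \<open>Evaluation\<close>

lemma sum_singles_keys: "(\<Sum>m\<in>Poly_Mapping.keys p. Poly_Mapping.single m (Poly_Mapping.lookup p m)) = p"
  by (rule poly_mapping_eqI)
    (auto simp: lookup_sum lookup_single when_def in_keys_iff sum.delta)

definition eval_monomial :: "(nat \<Rightarrow> 'a::comm_ring_1) \<Rightarrow> (nat \<Rightarrow>\<^sub>0 nat) \<Rightarrow> 'a" where
  "eval_monomial x m = (\<Prod>i\<in>Poly_Mapping.keys m. x i ^ Poly_Mapping.lookup m i)"

definition evaluate :: "(nat \<Rightarrow> 'a) \<Rightarrow> 'a::comm_ring_1 mpoly \<Rightarrow> 'a" where
  "evaluate x p = (\<Sum>m\<in>Poly_Mapping.keys p. Poly_Mapping.lookup p m * eval_monomial x m)"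

lemma eval_monomial_superset:
  assumes "finite A" "Poly_Mapping.keys m \<subseteq> A"
  shows "eval_monomial x m = (\<Prod>i\<in>A. x i ^ Poly_Mapping.lookup m i)"
  unfolding eval_monomial_def using assms
  by (intro prod.mono_neutral_left) (auto simp: in_keys_iff)

lemma eval_monomial_add: "eval_monomial x (m + k) = eval_monomial x m * eval_monomial x k"
proof -
  let ?A = "Poly_Mapping.keys m \<union> Poly_Mapping.keys k"
  have "eval_monomial x (m + k) = (\<Prod>i\<in>?A. x i ^ Poly_Mapping.lookup (m + k) i)"
    by (rule eval_monomial_superset) (auto simp: keys_add)
  also have "\<dots> = (\<Prod>i\<in>?A. x i ^ Poly_Mapping.lookup m i) * (\<Prod>i\<in>?A. x i ^ Poly_Mapping.lookup k i)"
    by (simp add: lookup_add power_add prod.distrib)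
  also have "\<dots> = eval_monomial x m * eval_monomial x k"
    by (simp flip: eval_monomial_superset)
  finally show ?thesis .
qed

lemma evaluate_superset:
  assumes "finite A" "Poly_Mapping.keys p \<subseteq> A"
  shows "evaluate x p = (\<Sum>m\<in>A. Poly_Mapping.lookup p m * eval_monomial x m)"
  unfolding evaluate_def using assms
  by (intro sum.mono_neutral_left) (auto simp: in_keys_iff)

lemma evaluate_single: "evaluate x (Poly_Mapping.single m k) = k * eval_monomial x m"
  by (simp add: evaluate_def)

lemma evaluate_zero [simp]: "evaluate x 0 = 0"
  by (simp add: evaluate_def)

lemma evaluate_one [simp]: "evaluate x 1 = 1"
  using evaluate_single[of x 0 1] by (simp add: eval_monomial_def)

lemma evaluate_var [simp]: "evaluate x (var i) = x i"
  by (simp add: var_def evaluate_single eval_monomial_def)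

lemma evaluate_add [simp]: "evaluate x (p + q) = evaluate x p + evaluate x q"
proof -
  let ?A = "Poly_Mapping.keys p \<union> Poly_Mapping.keys q"
  have "evaluate x (p + q) = (\<Sum>m\<in>?A. Poly_Mapping.lookup (p + q) m * eval_monomial x m)"
    by (rule evaluate_superset) (auto simp: keys_add)
  also have "\<dots> = (\<Sum>m\<in>?A. Poly_Mapping.lookup p m * eval_monomial x m)
      + (\<Sum>m\<in>?A. Poly_Mapping.lookup q m * eval_monomial x m)"
    by (simp add: lookup_add distrib_right sum.distrib)
  also have "\<dots> = evaluate x p + evaluate x q"
    by (simp flip: evaluate_superset)
  finally show ?thesis .
qed

lemma evaluate_uminus [simp]: "evaluate x (- p) = - evaluate x p"
  using evaluate_add[of x p "- p"] by (simp add: eq_neg_iff_add_eq_0 add.commute)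

lemma evaluate_diff [simp]: "evaluate x (p - q) = evaluate x p - evaluate x q"
  using evaluate_add[of x p "- q"] by simp

lemma evaluate_sum [simp]: "evaluate x (\<Sum>i\<in>A. f i) = (\<Sum>i\<in>A. evaluate x (f i))"
  by (induction A rule: infinite_finite_induct) auto

lemma evaluate_mult [simp]: "evaluate x (p * q) = evaluate x p * evaluate x q"
proof -
  have "p * q = (\<Sum>m\<in>Poly_Mapping.keys p. Poly_Mapping.single m (Poly_Mapping.lookup p m)) *
      (\<Sum>k\<in>Poly_Mapping.keys q. Poly_Mapping.single k (Poly_Mapping.lookup q k))"
    by (simp only: sum_singles_keys)
  also have "evaluate x \<dots> = evaluate x p * evaluate x q"
    by (simp add: evaluate_def[of x p] evaluate_def[of x q] sum_product mult_single
        evaluate_single eval_monomial_add mult_ac)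
  finally show ?thesis .
qed

lemma evaluate_power [simp]: "evaluate x (p ^ k) = evaluate x p ^ k"
  by (induction k) auto

section \<open>Division by a polynomial that is monic in one variable\<close>

text \<open>Degree bounds in the single variable with index \<open>i\<close>. Stating them as strict upper bounds
  covers the zero polynomial without a convention for its degree; in particular
  \<open>degree_less i (Suc 0) p\<close> says that \<open>x\<^sub>i\<close> does not occur in \<open>p\<close>.\<close>

definition degree_less :: "nat \<Rightarrow> nat \<Rightarrow> 'a::zero mpoly \<Rightarrow> bool" where
  "degree_less i d p \<longleftrightarrow> (\<forall>m\<in>Poly_Mapping.keys p. Poly_Mapping.lookup m i < d)"

lemma degree_less_mono: "degree_less i d p \<Longrightarrow> d \<le> e \<Longrightarrow> degree_less i e p"
  by (fastforce simp: degree_less_def)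

lemma degree_less_zero [simp]: "degree_less i d 0"
  by (simp add: degree_less_def)

lemma degree_less_add: "degree_less i d p \<Longrightarrow> degree_less i d q \<Longrightarrow> degree_less i d (p + q)"
  using keys_add[of p q] by (auto simp: degree_less_def)

lemma degree_less_uminus [simp]: "degree_less i d (- p) \<longleftrightarrow> degree_less i d (p :: 'a::ab_group_add mpoly)"
  by (simp add: degree_less_def in_keys_iff)

lemma degree_less_diff:
  fixes p q :: "'a::ab_group_add mpoly"
  shows "degree_less i d p \<Longrightarrow> degree_less i d q \<Longrightarrow> degree_less i d (p - q)"
  using degree_less_add[of i d p "- q"] by simp

lemma degree_less_mult:
  assumes "degree_less i (Suc d) p" "degree_less i e q"
  shows "degree_less i (d + e) (p * q)"
  unfolding degree_less_def
proof
  fix m assume "m \<in> Poly_Mapping.keys (p * q)"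
  then obtain s t where "m = s + t" "s \<in> Poly_Mapping.keys p" "t \<in> Poly_Mapping.keys q"
    using keys_mult[of p q] by blast
  then show "Poly_Mapping.lookup m i < d + e"
    using assms by (force simp: degree_less_def lookup_add)
qed

lemma degree_less_power:
  fixes p :: "'a::comm_ring_1 mpoly"
  shows "degree_less i (Suc 0) p \<Longrightarrow> degree_less i (Suc 0) (p ^ k)"
  by (induction k) (auto simp: degree_less_def[of _ _ 1] dest: degree_less_mult)

lemma degree_less_sum:
  "(\<And>j. j \<in> A \<Longrightarrow> degree_less i d (f j)) \<Longrightarrow> degree_less i d (\<Sum>j\<in>A. f j)"
  by (induction A rule: infinite_finite_induct) (auto intro: degree_less_add)

lemma degree_less_var: "i \<noteq> j \<Longrightarrow> degree_less i (Suc 0) (var j)"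
  by (simp add: degree_less_def var_def lookup_single)

lemma var_power: "var i ^ a = Poly_Mapping.single (Poly_Mapping.single i a) 1"
  by (induction a) (auto simp: var_def mult_single single_add[symmetric])

text \<open>A monomial \<open>m\<close> of \<open>q\<close> with the largest exponent of \<open>x\<^sub>i\<close> survives in the product:
  \<open>x\<^sub>i\<^sup>a m\<close> has an exponent too large to be cancelled by anything in \<open>c q\<close>. So a nonzero
  multiple of a polynomial that is monic of degree \<open>a\<close> in \<open>x\<^sub>i\<close> has degree at least \<open>a\<close>;
  this gives uniqueness of remainders.\<close>

lemma degree_monic_mult:
  fixes c q :: "'a::comm_ring_1 mpoly"
  assumes c: "degree_less i a c" and less: "degree_less i a ((var i ^ a + c) * q)"
  shows "q = 0"
proof (rule ccontr)
  assume "q \<noteq> 0"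
  define e where "e = Max ((\<lambda>m. Poly_Mapping.lookup m i) ` Poly_Mapping.keys q)"
  have "Poly_Mapping.keys q \<noteq> {}" using \<open>q \<noteq> 0\<close> by simp
  then obtain m where m: "m \<in> Poly_Mapping.keys q" "Poly_Mapping.lookup m i = e"
    using Max_in[of "(\<lambda>m. Poly_Mapping.lookup m i) ` Poly_Mapping.keys q"]
    unfolding e_def by fastforce
  have q: "degree_less i (Suc e) q"
    by (auto simp: degree_less_def e_def less_Suc_eq_le)
  let ?M = "Poly_Mapping.single i a + m"
  have M: "Poly_Mapping.lookup ?M i = e + a" using m by (simp add: lookup_add)
  have "degree_less i (e + a) (q * c)" by (rule degree_less_mult[OF q c])
  then have "?M \<notin> Poly_Mapping.keys (q * c)" using M by (auto simp: degree_less_def)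
  then have "Poly_Mapping.lookup (c * q) ?M = 0" by (simp add: in_keys_iff mult.commute)
  moreover have "Poly_Mapping.lookup (var i ^ a * q) ?M = Poly_Mapping.lookup q m"
  proof -
    have "var i ^ a * q = (\<Sum>k\<in>Poly_Mapping.keys q.
        Poly_Mapping.single (Poly_Mapping.single i a + k) (Poly_Mapping.lookup q k))"
      by (subst sum_singles_keys[of q, symmetric])
        (simp add: var_power sum_distrib_left mult_single)
    then show ?thesis
      using m by (simp add: lookup_sum lookup_single when_def)
  qed
  ultimately have "Poly_Mapping.lookup ((var i ^ a + c) * q) ?M \<noteq> 0"
    using m by (simp add: distrib_right lookup_add in_keys_iff)
  then have "Poly_Mapping.lookup ?M i < a"
    using less by (auto simp: degree_less_def in_keys_iff)
  then show False using M by simp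
qed

lemma poly_ring_uminus_closed: "p \<in> carrier (poly_ring n) \<Longrightarrow> - p \<in> carrier (poly_ring n)"
  by (simp add: poly_ring_def)

text \<open>Long division. A term \<open>x\<^sub>i\<^sup>a s\<close> is replaced by \<open>- s c\<close>, whose degree in \<open>x\<^sub>i\<close> is smaller
  than that of the term, so the process ends. The quotient stays in the ring
  of the first \<open>n\<close> variables, as membership in an ideal of that ring requires.\<close>

lemma monic_division:
  fixes c g :: "'a::comm_ring_1 mpoly"
  assumes c: "degree_less i a c" "c \<in> carrier (poly_ring n)" and i: "i \<in> {1..n}"
    and g: "g \<in> carrier (poly_ring n)"
  obtains u v where "u \<in> carrier (poly_ring n)" "degree_less i a v" "g = (var i ^ a + c) * u + v"
proof -
  let ?F = "var i ^ a + c"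
  \<comment> \<open>\<open>D\<close> is the set of polynomials that admit a division with remainder.\<close>
  define D where "D = {?F * u + v | u v. u \<in> carrier (poly_ring n) \<and> degree_less i a v}"
  have D_I: "?F * u + v \<in> D" if "u \<in> carrier (poly_ring n)" "degree_less i a v" for u v
    unfolding D_def using that by blast
  have rem: "v \<in> D" if "degree_less i a v" for v
    using D_I[OF poly_ring_zero_closed that] by simp
  have zero: "0 \<in> D" by (simp add: rem)
  have add: "p + q \<in> D" if pq: "p \<in> D" "q \<in> D" for p q
  proof -
    from pq obtain u v u' v' where
      "p = ?F * u + v" "u \<in> carrier (poly_ring n)" "degree_less i a v"
      "q = ?F * u' + v'" "u' \<in> carrier (poly_ring n)" "degree_less i a v'"
      unfolding D_def by blast
    then have "p + q = ?F * (u + u') + (v + v')" "u + u' \<in> carrier (poly_ring n)"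
      "degree_less i a (v + v')"
      by (auto simp: algebra_simps poly_ring_add_closed degree_less_add)
    then show ?thesis unfolding D_def by blast
  qed
  have sum: "(\<Sum>m\<in>A. f m) \<in> D" if "\<And>m. m \<in> A \<Longrightarrow> f m \<in> D"
    for A and f :: "(nat \<Rightarrow>\<^sub>0 nat) \<Rightarrow> 'a mpoly"
    using that by (induction A rule: infinite_finite_induct) (auto intro: zero add)
  have "p \<in> D" if "p \<in> carrier (poly_ring n)" "degree_less i d p" for p d
    using that
  proof (induction d arbitrary: p rule: less_induct)
    case (less d)
    have "Poly_Mapping.single m (Poly_Mapping.lookup p m) \<in> D"
      if m: "m \<in> Poly_Mapping.keys p" for m
    proof (cases "Poly_Mapping.lookup m i < a")
      case True
      then show ?thesis by (intro rem) (simp add: degree_less_def)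
    next
      case False
      define s where "s = Poly_Mapping.single (m - Poly_Mapping.single i a) (Poly_Mapping.lookup p m)"
      have m_eq: "Poly_Mapping.single i a + (m - Poly_Mapping.single i a) = m"
        using False by (intro poly_mapping_eqI)
          (auto simp: lookup_add lookup_minus lookup_single when_def)
      have s: "s \<in> carrier (poly_ring n)"
      proof -
        have "Poly_Mapping.keys (m - Poly_Mapping.single i a) \<subseteq> Poly_Mapping.keys m"
          by (auto simp: in_keys_iff lookup_minus)
        also have "\<dots> \<subseteq> {1..n}" using m less.prems(1) by (simp add: poly_ring_def)
        finally show ?thesis by (simp add: s_def poly_ring_def)
      qed
      have "degree_less i (Suc (Poly_Mapping.lookup m i - a)) s"
        by (simp add: s_def degree_less_def lookup_minus)
      from degree_less_mult[OF this c(1)] False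
      have "degree_less i (Poly_Mapping.lookup m i) (- (s * c))" by simp
      moreover have "Poly_Mapping.lookup m i < d"
        using m less.prems(2) by (auto simp: degree_less_def)
      moreover have "- (s * c) \<in> carrier (poly_ring n)"
        by (intro poly_ring_uminus_closed poly_ring_mult_closed s c)
      ultimately have "- (s * c) \<in> D" using less.IH by blast
      moreover have "?F * s \<in> D" using D_I[OF s degree_less_zero] by simp
      ultimately have "?F * s + - (s * c) \<in> D" by (rule add[rotated])
      moreover have "?F * s + - (s * c) = Poly_Mapping.single m (Poly_Mapping.lookup p m)"
        using m_eq by (simp add: algebra_simps var_power s_def mult_single)
      ultimately show ?thesis by simp
    qed
    then have "(\<Sum>m\<in>Poly_Mapping.keys p. Poly_Mapping.single m (Poly_Mapping.lookup p m)) \<in> D"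
      by (rule sum)
    then show ?case by (simp only: sum_singles_keys)
  qed
  moreover have "degree_less i (Suc (Max ((\<lambda>m. Poly_Mapping.lookup m i) ` Poly_Mapping.keys g))) g"
    by (auto simp: degree_less_def less_Suc_eq_le)
  ultimately have "g \<in> D" using g by blast
  then show thesis using that unfolding D_def by blast
qed

text \<open>Multiplication by \<open>r\<close> does not raise the degree in \<open>x\<^sub>i\<close>. So if \<open>v\<close> is the remainder of
  \<open>g\<close>, then \<open>r v\<close> is a multiple of the monic polynomial of too small a degree, hence zero, and
  \<open>v = 0\<close> because the ring is a domain.\<close>

lemma monic_dvd_mult_cancel:
  fixes c g r :: "'a::idom mpoly"
  assumes c: "degree_less i a c" "c \<in> carrier (poly_ring n)" and i: "i \<in> {1..n}"
    and g: "g \<in> carrier (poly_ring n)"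
    and r: "degree_less i (Suc 0) r" "r \<noteq> 0"
    and dvd: "(var i ^ a + c) dvd r * g"
  shows "\<exists>u\<in>carrier (poly_ring n). g = (var i ^ a + c) * u"
proof -
  obtain u v where uv: "u \<in> carrier (poly_ring n)" "degree_less i a v" "g = (var i ^ a + c) * u + v"
    using monic_division[OF c i g] by blast
  have "r * v = r * g - (var i ^ a + c) * (r * u)"
    by (simp add: uv(3) algebra_simps)
  then have "(var i ^ a + c) dvd r * v" using dvd by simp
  then obtain q where q: "r * v = (var i ^ a + c) * q" by (elim dvdE)
  moreover have "degree_less i a (r * v)"
    using degree_less_mult[OF r(1) uv(2)] by simp
  ultimately have "q = 0" using degree_monic_mult[OF c(1)] by metis
  then have "v = 0" using q r(2) by simp
  then show ?thesis using uv by auto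
qed

section \<open>Elimination of a variable from two power sums\<close>

lemma diff_dvd_power_diff:
  fixes x y :: "'a::comm_ring_1"
  shows "x - y dvd x ^ k - y ^ k"
  by (metis dvd_triv_left power_diff_sumr2)

text \<open>Modulo \<open>x\<^sup>a + c\<close> the power \<open>x\<^sup>a\<^sup>b\<close> becomes \<open>(-c)\<^sup>b\<close>, modulo \<open>x\<^sup>b + d\<close> it becomes
  \<open>(-d)\<^sup>a\<close>; the difference of the two lies in the ideal that both generate.\<close>

lemma eliminant_dvd:
  fixes x c d g :: "'a::comm_ring_1"
  assumes "x ^ a + c dvd (x ^ b + d) * g"
  shows "x ^ a + c dvd ((- c) ^ b - (- d) ^ a) * g"
proof -
  have "x ^ a + c dvd (x ^ a) ^ b - (- c) ^ b"
    using diff_dvd_power_diff[of "x ^ a" "- c" b] by simp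
  then have 1: "x ^ a + c dvd ((x ^ a) ^ b - (- c) ^ b) * g" by simp
  have "x ^ b + d dvd (x ^ b) ^ a - (- d) ^ a"
    using diff_dvd_power_diff[of "x ^ b" "- d" a] by simp
  then have "(x ^ b + d) * g dvd ((x ^ b) ^ a - (- d) ^ a) * g" by (rule mult_dvd_mono) simp
  with assms have 2: "x ^ a + c dvd ((x ^ b) ^ a - (- d) ^ a) * g" by (rule dvd_trans)
  \<comment> \<open>The two occurrences of \<open>x\<^sup>a\<^sup>b\<close> cancel.\<close>
  have "((- c) ^ b - (- d) ^ a) * g =
      ((x ^ b) ^ a - (- d) ^ a) * g - ((x ^ a) ^ b - (- c) ^ b) * g"
    by (simp add: algebra_simps flip: power_mult)
  then show ?thesis using dvd_diff[OF 2 1] by simp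
qed

text \<open>Two coordinates equal to \<open>1\<close> are needed: with a single one, \<open>c\<close> and \<open>d\<close> would both
  evaluate to \<open>1\<close>, and \<open>(-1)\<^sup>b = (-1)\<^sup>a\<close> when \<open>a\<close> and \<open>b\<close> have the same parity.\<close>

lemma power_sum_tail_nonzero:
  assumes "n \<ge> 3" "0 < a" "a < b"
  shows "(- (\<Sum>j=2..n. var j ^ a)) ^ b - (- (\<Sum>j=2..n. var j ^ b)) ^ a \<noteq> (0 :: complex mpoly)"
    (is "?r \<noteq> 0")
proof
  assume r: "?r = 0"
  define x :: "nat \<Rightarrow> complex" where "x j = (if j \<in> {2, 3} then 1 else 0)" for j
  have two: "(\<Sum>j=2..n. x j ^ k) = 2" if "k > 0" for k
  proof -
    have "(\<Sum>j=2..n. x j ^ k) = (\<Sum>j\<in>{2, 3}. x j ^ k)"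
      using assms(1) that by (intro sum.mono_neutral_right) (auto simp: x_def)
    then show ?thesis by (simp add: x_def)
  qed
  from r have "evaluate x ?r = 0" by (simp del: evaluate_diff)
  then have "(- 2 :: complex) ^ b = (- 2) ^ a"
    using two[of a] two[of b] assms by simp
  \<comment> \<open>Passing to absolute values removes the signs.\<close>
  then have "norm ((- 2 :: complex) ^ b) = norm ((- 2 :: complex) ^ a)" by simp
  then have "(2 :: real) ^ b = 2 ^ a" by (simp add: norm_power)
  then show False using assms(3) by simp
qed

lemma sum_powers_closed:
  "A \<subseteq> {1..n} \<Longrightarrow> (\<Sum>j\<in>A. var j ^ k) \<in> carrier (poly_ring n)"
  unfolding poly_ring_def using keys_sum[of "\<lambda>j. var j ^ k" A]
  by (fastforce simp: var_power split: if_splits)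

lemma power_sum_split:
  assumes "n > 0"
  shows "power_sum n k = var 1 ^ k + (\<Sum>j=2..n. var j ^ k)"
  using assms sum.atLeast_Suc_atMost[of 1 n "\<lambda>j. var j ^ k"]
  by (simp add: power_sum_def numeral_2_eq_2)

lemma power_sum_dvd_mult_cancel:
  fixes g :: "complex mpoly"
  assumes "n \<ge> 3" "0 < a" "a < b" and g: "g \<in> carrier (poly_ring n)"
    and dvd: "power_sum n a dvd power_sum n b * g"
  shows "\<exists>u\<in>carrier (poly_ring n). g = power_sum n a * u"
proof -
  define c d :: "complex mpoly"
    where "c = (\<Sum>j=2..n. var j ^ a)" and "d = (\<Sum>j=2..n. var j ^ b)"
  have split: "power_sum n a = var 1 ^ a + c" "power_sum n b = var 1 ^ b + d"
    using assms(1) by (simp_all add: power_sum_split c_def d_def)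
  have free: "degree_less 1 (Suc 0) c" "degree_less 1 (Suc 0) d"
    by (auto simp: c_def d_def intro!: degree_less_sum degree_less_power degree_less_var)
  have "degree_less 1 a c" using free(1) assms(2) by (auto elim: degree_less_mono)
  moreover have "c \<in> carrier (poly_ring n)"
    unfolding c_def by (rule sum_powers_closed) auto
  moreover have "degree_less 1 (Suc 0) ((- c) ^ b - (- d) ^ a)"
    using free by (auto intro!: degree_less_diff degree_less_power)
  moreover have "(- c) ^ b - (- d) ^ a \<noteq> 0"
    using power_sum_tail_nonzero[OF assms(1-3)] by (simp add: c_def d_def)
  moreover have "var 1 ^ a + c dvd ((- c) ^ b - (- d) ^ a) * g"
    using dvd unfolding split by (rule eliminant_dvd)
  ultimately show ?thesis
    unfolding split using assms(1) g by (intro monic_dvd_mult_cancel) auto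
qed

section \<open>Regularity of two power sums\<close>

lemma power_sum_nonzero:
  assumes "n > 0"
  shows "(power_sum n k :: complex mpoly) \<noteq> 0"
proof
  assume "(power_sum n k :: complex mpoly) = 0"
  then have "evaluate (\<lambda>_. 1) (power_sum n k :: complex mpoly) = 0" by simp
  then show False using assms by (simp add: power_sum_def)
qed

text \<open>The polynomials that vanish at a common zero form an ideal without \<open>1\<close>.\<close>

lemma genideal_proper_if_common_zero:
  fixes fs :: "'a::comm_ring_1 mpoly set"
  assumes "fs \<subseteq> carrier (poly_ring n)" and zero: "\<And>f. f \<in> fs \<Longrightarrow> evaluate x f = 0"
  shows "genideal (poly_ring n) fs \<noteq> carrier (poly_ring n)"
proof
  interpret R: cring "poly_ring n :: 'a mpoly ring" by (rule poly_ring_cring)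
  let ?K = "{f \<in> carrier (poly_ring n). evaluate x f = 0}"
  assume eq: "genideal (poly_ring n) fs = carrier (poly_ring n)"
  have inv: "\<ominus>\<^bsub>poly_ring n\<^esub> f = - f" if "f \<in> carrier (poly_ring n)" for f :: "'a mpoly"
    using that by (intro R.minus_equality) (auto simp: poly_ring_uminus_closed)
  have "subgroup ?K (add_monoid (poly_ring n))"
    by (rule R.add.subgroupI)
      (auto simp: poly_ring_add_closed poly_ring_uminus_closed inv
        intro: exI[of _ 0] poly_ring_zero_closed simp flip: a_inv_def)
  then have "ideal ?K (poly_ring n)"
    by (rule idealI[OF R.ring_axioms]) (auto simp: poly_ring_mult_closed)
  then have "genideal (poly_ring n) fs \<subseteq> ?K"
    by (rule R.genideal_minimal) (use assms in auto)
  then have "(1 :: 'a mpoly) \<in> ?K" using eq poly_ring_one_closed by blast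
  then show False by simp
qed

theorem theorem4p1:
  fixes n a b :: nat
  assumes "n \<ge> 3" and "0 < a" and "a < b"
  shows "regular_sequence (poly_ring n :: complex mpoly ring) [power_sum n a, power_sum n b]"
proof -
  let ?R = "poly_ring n :: complex mpoly ring"
  let ?p = "\<lambda>k. power_sum n k :: complex mpoly"
  interpret R: cring ?R by (rule poly_ring_cring)
  have closed: "?p k \<in> carrier ?R" for k by (rule power_sum_in_poly_ring)
  have "genideal ?R {?p a, ?p b} \<noteq> carrier ?R"
    using assms closed
    by (intro genideal_proper_if_common_zero[where x = "\<lambda>_. 0"]) (auto simp: power_sum_def)
  moreover have "nonzerodivisor (?R Quot genideal ?R {}) (genideal ?R {} +>\<^bsub>?R\<^esub> ?p a)"
  proof -
    have "genideal ?R {} \<subseteq> {0}"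
      using R.genideal_minimal[OF R.zeroideal, of "{}"] by simp
    moreover have ideal: "ideal (genideal ?R {}) ?R" by (rule R.genideal_ideal) simp
    moreover have "0 \<in> genideal ?R {}"
      using additive_subgroup.zero_closed[OF ideal.axioms(1)[OF ideal]] by simp
    ultimately show ?thesis
      using closed power_sum_nonzero[of n a] assms(1)
      by (subst nonzerodivisor_Quot_iff) auto
  qed
  moreover have "nonzerodivisor (?R Quot genideal ?R {?p a}) (genideal ?R {?p a} +>\<^bsub>?R\<^esub> ?p b)"
  proof -
    have mem: "f \<in> genideal ?R {?p a} \<longleftrightarrow> (\<exists>u\<in>carrier ?R. f = ?p a * u)" for f
      using R.cgenideal_eq_genideal[OF closed[of a]]
      by (auto simp: cgenideal_def mult.commute)
    have "ideal (genideal ?R {?p a}) ?R" by (rule R.genideal_ideal) (simp add: closed)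
    then show ?thesis
      using closed power_sum_dvd_mult_cancel[OF assms]
      by (subst nonzerodivisor_Quot_iff) (auto simp: mem)
  qed
  ultimately show ?thesis
    using closed by (auto simp: regular_sequence_def less_Suc_eq)
qed

end
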